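(* Let $h>0$, let $\omega$ be the unique positive solution of $h=\frac{\omega}{2}e^{\omega^2/4}$, and let $U(\eta)=h\int_\eta^\omega e^{-r^2/4}\,dr$ for $\eta\in[0,\omega]$. If we set $$u(x,t)=U\!\left(\frac{x}{\sqrt{t+1}}\right)\quad\text{and}\quad \sigma(t)=\omega\sqrt{t+1},$$ for $t>0$ and $0\le x\le\sigma(t)$, then $(u,\sigma)$ satisfies $$\begin{array}{ll} u_t(x,t)-u_{xx}(x,t)=0, & t>0,\ 0<x<\sigma(t),\\ -u_x(0,t)=\dfrac{h}{\sqrt{t+1}},\quad u(\sigma(t),t)=0, & t>0,\\ \dot\sigma(t)=-u_x(\sigma(t),t), & t>0.\end{array}$$
   Context: The pair $(U,\omega)$ is the unique solution of the stationary problem $U''(\eta)+\frac{\eta}{2}U'(\eta)=0$ for $0<\eta<\omega$, $-U'(0)=h$, $U(\omega)=0$, $\frac{\omega}{2}=-U'(\omega)$. Derivatives at the boundary points $x=0$ and $x=\sigma(t)$ are one-sided. *)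

theory Defs
  imports "HOL-Analysis.Analysis"
begin

lemma ex1_front_coefficient:
  fixes h :: real
  assumes "h > 0"
  shows "\<exists>!w. w > 0 \<and> h = w / 2 * exp (w\<^sup>2 / 4)"
proof -
  define f where "f = (\<lambda>w::real. w / 2 * exp (w\<^sup>2 / 4))"
  have less: "f v < f w" if "0 \<le> v" "v < w" for v w
  proof -
    have "v\<^sup>2 < w\<^sup>2"
      using that by (simp add: power_strict_mono)
    then have "exp (v\<^sup>2 / 4) < exp (w\<^sup>2 / 4)"
      by simp
    then show ?thesis
      unfolding f_def using that by (intro mult_strict_mono) auto
  qed
  have "1 \<le> exp ((2 * h)\<^sup>2 / 4)"
    by simp
  then have up: "h \<le> f (2 * h)"
    using assms mult_left_mono[of 1 "exp ((2 * h)\<^sup>2 / 4)" h] by (simp add: f_def)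
  have "continuous_on {0..2 * h} f"
    unfolding f_def by (intro continuous_intros) auto
  then have "\<exists>w\<ge>0. w \<le> 2 * h \<and> f w = h"
    using IVT'[of f 0 h "2 * h"] up assms by (simp add: f_def)
  then obtain w where w: "w \<ge> 0" "f w = h" by blast
  have "w \<noteq> 0" using w assms by (auto simp: f_def)
  have "w > 0 \<and> h = f w"
    using w \<open>w \<noteq> 0\<close> by simp
  moreover have "v = w" if "v > 0 \<and> h = f v" for v
  proof (rule linorder_cases[of v w])
    assume "v < w"
    then show ?thesis using less[of v w] that w by linarith
  next
    assume "w < v"
    then show ?thesis using less[of w v] that w by linarith
  qed simp
  ultimately show ?thesis
    unfolding f_def by blast
qed

end

theory Submission imports Defs begin

text \<open>
  A function \<open>u x t = U (x / sqrt (t + 1))\<close> of the similarity variable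
  \<open>\<eta> = x / sqrt (t + 1)\<close> satisfies, by the chain rule,
  \<open>u_t = - (\<eta> / 2) * U' \<eta> / (t + 1)\<close> and \<open>u_xx = U'' \<eta> / (t + 1)\<close>, so the heat equation
  for \<open>u\<close> is the ordinary differential equation \<open>U'' + \<eta> / 2 * U' = 0\<close> for \<open>U\<close>. Its solutions
  have Gaussian derivatives, and for \<open>U' \<eta> = - h * exp (- \<eta>\<^sup>2 / 4)\<close> the flux at
  \<open>\<eta> = 0\<close> is \<open>h\<close>. On the curve \<open>\<sigma> t = \<omega> * sqrt (t + 1)\<close> the similarity variable is
  constantly \<open>\<omega>\<close>; hence \<open>u\<close> vanishes there, and both \<open>\<sigma>' t\<close> and \<open>- u_x (\<sigma> t) t\<close> are
  constants divided by \<open>sqrt (t + 1)\<close>. The constants \<open>\<omega> / 2\<close> and \<open>h * exp (- \<omega>\<^sup>2 / 4)\<close> agree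
  precisely when \<open>\<omega>\<close> solves the transcendental equation that defines it.

  The analytic input is the fundamental theorem of calculus for the profile
  (\<open>Gaussian_profile_derivative\<close>) and the two chain rules (\<open>similarity_space_derivative\<close>,
  \<open>similarity_time_derivative\<close>). Since \<open>u\<close> is determined only for
  \<open>0 \<le> x \<le> \<sigma> t\<close>, each chain rule also has to show that the points at which the difference
  quotient is evaluated stay in that region.
\<close>

lemma front_coefficient:
  fixes h \<omega> :: real
  assumes "h > 0" and "\<omega> = (THE w. w > 0 \<and> h = w / 2 * exp (w\<^sup>2 / 4))"
  shows "\<omega> > 0" and "h = \<omega> / 2 * exp (\<omega>\<^sup>2 / 4)"
  using theI'[OF ex1_front_coefficient[OF assms(1)], folded assms(2)] by auto

text \<open>
  The variable is the lower limit of integration, so the integral over \<open>{\<eta>..\<omega>}\<close> is rewritten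
  as a constant minus the integral over \<open>{0..\<eta>}\<close>, to which the fundamental theorem applies.
\<close>

lemma Gaussian_profile_derivative:
  fixes U :: "real \<Rightarrow> real"
  assumes U: "\<And>\<eta>. \<eta> \<in> {0..\<omega>} \<Longrightarrow> U \<eta> = h * integral {\<eta>..\<omega>} (\<lambda>r. exp (- (r\<^sup>2) / 4))"
    and "\<eta> \<in> {0..\<omega>}"
  shows "(U has_real_derivative - h * exp (- (\<eta>\<^sup>2) / 4)) (at \<eta> within {0..\<omega>})"
proof -
  define g :: "real \<Rightarrow> real" where "g = (\<lambda>r. exp (- (r\<^sup>2) / 4))"
  have cont: "continuous_on S g" for S
    unfolding g_def by (intro continuous_intros) auto
  have U_eq: "U y = h * (integral {0..\<omega>} g - integral {0..y} g)" if "y \<in> {0..\<omega>}" for y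
  proof -
    have "integral {0..y} g + integral {y..\<omega>} g = integral {0..\<omega>} g"
      using that by (intro Henstock_Kurzweil_Integration.integral_combine
          integrable_continuous_interval cont) auto
    then show ?thesis
      using U[OF that] by (simp add: g_def)
  qed
  have "((\<lambda>y. integral {0..y} g) has_real_derivative g \<eta>) (at \<eta> within {0..\<omega>})"
    using cont assms(2) by (rule integral_has_real_derivative)
  then have "((\<lambda>y. h * (integral {0..\<omega>} g - integral {0..y} g)) has_real_derivative
      - h * exp (- (\<eta>\<^sup>2) / 4)) (at \<eta> within {0..\<omega>})"
    by (auto intro!: derivative_eq_intros simp: g_def)
  then show ?thesis
    by (rule has_field_derivative_transform_within[OF _ zero_less_one assms(2)]) (simp add: U_eq)
qed

lemma Gaussian_derivative:
  "((\<lambda>\<eta>::real. - h * exp (- (\<eta>\<^sup>2) / 4)) has_real_derivative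
      - (\<eta> / 2) * (- h * exp (- (\<eta>\<^sup>2) / 4))) (at \<eta>)"
  by (auto intro!: derivative_eq_intros)

text \<open>
  For fixed \<open>t\<close> the similarity variable maps \<open>{0..\<omega> * sqrt (t + 1)}\<close> onto \<open>{0..\<omega>}\<close>; this is
  why one-sided derivatives of \<open>U\<close> at the two endpoints suffice for those of \<open>u\<close>.
\<close>

lemma similarity_space_derivative:
  fixes U v :: "real \<Rightarrow> real" and t x \<omega> D :: real
  assumes "t > -1"
    and x: "x \<in> {0..\<omega> * sqrt (t + 1)}"
    and U: "(U has_real_derivative D) (at (x / sqrt (t + 1)) within {0..\<omega>})"
    and v: "\<And>y. y \<in> {0..\<omega> * sqrt (t + 1)} \<Longrightarrow> v y = U (y / sqrt (t + 1))"
  shows "(v has_real_derivative D / sqrt (t + 1)) (at x within {0..\<omega> * sqrt (t + 1)})"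
proof -
  let ?I = "{0..\<omega> * sqrt (t + 1)}"
  have pos: "sqrt (t + 1) > 0"
    using assms(1) by simp
  have "(\<lambda>y. y / sqrt (t + 1)) ` ?I \<subseteq> {0..\<omega>}"
    using pos by (auto simp: field_simps)
  with U have "(U has_real_derivative D)
      (at (x / sqrt (t + 1)) within (\<lambda>y. y / sqrt (t + 1)) ` ?I)"
    by (rule DERIV_subset)
  moreover have "((\<lambda>y. y / sqrt (t + 1)) has_real_derivative 1 / sqrt (t + 1)) (at x within ?I)"
    by (intro DERIV_cdivide DERIV_ident)
  ultimately have "((\<lambda>y. U (y / sqrt (t + 1))) has_real_derivative D * (1 / sqrt (t + 1)))
      (at x within ?I)"
    using DERIV_image_chain by (fastforce simp: o_def)
  then have "((\<lambda>y. U (y / sqrt (t + 1))) has_real_derivative D / sqrt (t + 1)) (at x within ?I)"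
    by simp
  then show ?thesis
    by (rule has_field_derivative_transform_within[OF _ zero_less_one x]) (simp add: v)
qed

text \<open>
  The formula for \<open>v\<close> is only available up to the moving front, but the front moves continuously:
  a point strictly behind it at time \<open>t\<close> is behind it at all nearby times.
\<close>

lemma similarity_time_derivative:
  fixes U v :: "real \<Rightarrow> real" and t x \<omega> D :: real
  assumes "t > 0"
    and x: "0 < x" "x < \<omega> * sqrt (t + 1)"
    and U: "(U has_real_derivative D) (at (x / sqrt (t + 1)))"
    and v: "\<And>s. s > 0 \<Longrightarrow> x \<in> {0..\<omega> * sqrt (s + 1)} \<Longrightarrow> v s = U (x / sqrt (s + 1))"
  shows "(v has_real_derivative - (x / sqrt (t + 1) / 2) * D / (t + 1)) (at t)"
proof -
  have pos: "sqrt (t + 1) > 0" "sqrt (t + 1) * sqrt (t + 1) = t + 1"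
    using assms(1) by auto
  have "((\<lambda>s. x / sqrt (s + 1)) has_real_derivative - (x / sqrt (t + 1) / 2) / (t + 1)) (at t)"
    using assms(1) pos by (auto intro!: derivative_eq_intros simp: field_simps)
  from DERIV_chain2[OF U this]
  have "((\<lambda>s. U (x / sqrt (s + 1))) has_real_derivative
      - (x / sqrt (t + 1) / 2) * D / (t + 1)) (at t)"
    by (simp add: mult.commute)
  moreover have "eventually (\<lambda>s. s > 0) (nhds t)"
    using assms(1) by (intro eventually_nhds_in_open[of "{0<..}", simplified]) auto
  moreover have "eventually (\<lambda>s. \<omega> * sqrt (s + 1) > x) (nhds t)"
  proof -
    have "((\<lambda>s. \<omega> * sqrt (s + 1)) \<longlongrightarrow> \<omega> * sqrt (t + 1)) (nhds t)"
      by (intro tendsto_intros filterlim_ident)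
    then show ?thesis
      using x(2) by (rule order_tendstoD)
  qed
  ultimately show ?thesis
  proof (subst DERIV_cong_ev[OF refl _ refl, of v "\<lambda>s. U (x / sqrt (s + 1))"])
    assume "eventually (\<lambda>s. s > 0) (nhds t)" "eventually (\<lambda>s. \<omega> * sqrt (s + 1) > x) (nhds t)"
    then show "eventually (\<lambda>s. v s = U (x / sqrt (s + 1))) (nhds t)"
      by eventually_elim (use x in \<open>auto intro: v\<close>)
  qed
qed

theorem corollary1:
  fixes h \<omega> :: real
    and U \<sigma> :: "real \<Rightarrow> real"
    and u :: "real \<Rightarrow> real \<Rightarrow> real"
  assumes "h > 0"
    and "\<omega> = (THE w. w > 0 \<and> h = w / 2 * exp (w\<^sup>2 / 4))"
    and "\<And>\<eta>. \<eta> \<in> {0..\<omega>} \<Longrightarrow> U \<eta> = h * integral {\<eta>..\<omega>} (\<lambda>r. exp (- (r\<^sup>2) / 4))"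
    and "\<And>t. t > 0 \<Longrightarrow> \<sigma> t = \<omega> * sqrt (t + 1)"
    and "\<And>x t. t > 0 \<Longrightarrow> x \<in> {0..\<sigma> t} \<Longrightarrow> u x t = U (x / sqrt (t + 1))"
  shows "\<exists>u_t u_x u_xx :: real \<Rightarrow> real \<Rightarrow> real.
    (\<forall>t>0. \<forall>x\<in>{0..\<sigma> t}.
      ((\<lambda>y. u y t) has_real_derivative u_x x t) (at x within {0..\<sigma> t})) \<and>
    (\<forall>t>0. \<forall>x\<in>{0<..<\<sigma> t}.
      ((\<lambda>s. u x s) has_real_derivative u_t x t) (at t) \<and>
      ((\<lambda>y. u_x y t) has_real_derivative u_xx x t) (at x) \<and>
      u_t x t - u_xx x t = 0) \<and>
    (\<forall>t>0. - u_x 0 t = h / sqrt (t + 1) \<and> u (\<sigma> t) t = 0) \<and>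
    (\<forall>t>0. (\<sigma> has_real_derivative - u_x (\<sigma> t) t) (at t))"
proof -
  note sigma = assms(4) and u = assms(5)
  note omega = front_coefficient[OF assms(1,2)]
  define V where "V = (\<lambda>\<eta>::real. - h * exp (- (\<eta>\<^sup>2) / 4))"
  have dU: "(U has_real_derivative V \<eta>) (at \<eta> within {0..\<omega>})" if "\<eta> \<in> {0..\<omega>}" for \<eta>
    using Gaussian_profile_derivative[OF assms(3) that] by (simp add: V_def)
  have dV: "(V has_real_derivative - (\<eta> / 2) * V \<eta>) (at \<eta>)" for \<eta>
    unfolding V_def by (rule Gaussian_derivative)
  have V_omega: "V \<omega> = - (\<omega> / 2)"
  proof -
    have "V \<omega> = - (\<omega> / 2) * (exp (\<omega>\<^sup>2 / 4) * exp (- (\<omega>\<^sup>2) / 4))"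
      unfolding V_def by (subst omega(2)) simp
    also have "exp (\<omega>\<^sup>2 / 4) * exp (- (\<omega>\<^sup>2) / 4) = 1"
      by (simp flip: exp_add)
    finally show ?thesis
      by simp
  qed
  have "U \<omega> = 0"
    using assms(3)[of \<omega>] omega(1) by simp
  define u_x where "u_x = (\<lambda>x t. V (x / sqrt (t + 1)) / sqrt (t + 1))"
  \<comment> \<open>The chain rule gives this function for \<open>u_t\<close>; by the profile equation \<open>dV\<close> it is also \<open>u_xx\<close>.\<close>
  define w where "w = (\<lambda>x t. - (x / sqrt (t + 1) / 2) * V (x / sqrt (t + 1)) / (t + 1))"
  have space: "((\<lambda>y. u y t) has_real_derivative u_x x t) (at x within {0..\<sigma> t})"
    if "t > 0" "x \<in> {0..\<sigma> t}" for t x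
    unfolding sigma[OF that(1)] u_x_def
  proof (rule similarity_space_derivative)
    show "(U has_real_derivative V (x / sqrt (t + 1))) (at (x / sqrt (t + 1)) within {0..\<omega>})"
      using that by (intro dU) (auto simp: sigma field_simps)
  qed (use that sigma u in auto)
  have time: "((\<lambda>s. u x s) has_real_derivative w x t) (at t)"
    if "t > 0" "x \<in> {0<..<\<sigma> t}" for t x
    unfolding w_def
  proof (rule similarity_time_derivative)
    have "0 < x / sqrt (t + 1)" "x / sqrt (t + 1) < \<omega>"
      using that by (auto simp: sigma field_simps)
    then show "(U has_real_derivative V (x / sqrt (t + 1))) (at (x / sqrt (t + 1)))"
      using dU[of "x / sqrt (t + 1)"] by (simp add: at_within_Icc_at)
  qed (use that sigma u in auto)
  have second: "((\<lambda>y. u_x y t) has_real_derivative w x t) (at x)" if "t > 0" for t x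
  proof -
    have sq: "sqrt (t + 1) * sqrt (t + 1) = t + 1"
      using that by auto
    have "((\<lambda>y. y / sqrt (t + 1)) has_real_derivative 1 / sqrt (t + 1)) (at x)"
      by (intro DERIV_cdivide DERIV_ident)
    from DERIV_cdivide[OF DERIV_chain2[OF dV this], of "sqrt (t + 1)"]
    have "((\<lambda>y. u_x y t) has_real_derivative
        - (x / sqrt (t + 1) / 2) * V (x / sqrt (t + 1)) * (1 / sqrt (t + 1)) / sqrt (t + 1)) (at x)"
      by (simp only: u_x_def)
    then show ?thesis
      by (simp only: w_def times_divide_eq_right mult_1_right divide_divide_eq_left sq)
  qed
  have fixed: "- u_x 0 t = h / sqrt (t + 1)" for t
    by (simp add: u_x_def V_def)
  have front: "u (\<sigma> t) t = 0" if "t > 0" for t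
    using that omega(1) \<open>U \<omega> = 0\<close> by (simp add: u sigma)
  have speed: "(\<sigma> has_real_derivative - u_x (\<sigma> t) t) (at t)" if "t > 0" for t
  proof -
    have "((\<lambda>s. \<omega> * sqrt (s + 1)) has_real_derivative \<omega> / 2 / sqrt (t + 1)) (at t)"
      using that by (auto intro!: derivative_eq_intros simp: field_simps)
    moreover have "- u_x (\<sigma> t) t = \<omega> / 2 / sqrt (t + 1)"
      using that by (simp add: u_x_def sigma V_omega)
    moreover have "(\<sigma> has_real_derivative D) (at t)"
      if "((\<lambda>s. \<omega> * sqrt (s + 1)) has_real_derivative D) (at t)" for D
      using that by (rule has_field_derivative_transform_within_open[of _ _ _ "{0<..}"])
        (use \<open>t > 0\<close> sigma in auto)
    ultimately show ?thesis
      by simp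
  qed
  show ?thesis
    by (intro exI[of _ w] exI[of _ u_x]) (use space time second fixed front speed in auto)
qed

end
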